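(* Let $n\geq 3$ be an integer. Let $\mathcal{D}$ be a division ring with $\mathrm{char}(\mathcal{D})>n$ or $\mathrm{char}(\mathcal{D})=0$. Let $\mathcal{R}=M_m(\mathcal{D})$ with $m>1$, and let $f,g:\mathcal{R}\rightarrow \mathcal{R}$ be additive maps satisfying the identity \[ f(X)+X^n g(X^{-1})=0 \] for all $X\in \mathcal{R}^{\times}$. Then $f=0$ and $g=0$.
   Context: Division rings are associative and not necessarily commutative. $M_m(\mathcal{D})$ is the ring of $m\times m$ matrices over $\mathcal{D}$, and $\mathcal{R}^{\times}$ denotes the set of all invertible elements of the ring $\mathcal{R}$. A map is additive if it is a homomorphism of additive groups. *)

theory Defs
  imports "HOL-Analysis.Analysis"
begin

(* Powers with respect to the ring product ** of square matrices; the class operations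
   on vectors, and hence the overloaded power, act entrywise. *)
primrec matrix_power :: "'a::semiring_1 ^ 'm ^ 'm \<Rightarrow> nat \<Rightarrow> 'a ^ 'm ^ 'm" where
  "matrix_power A 0 = mat 1"
| "matrix_power A (Suc k) = A ** matrix_power A k"

end

theory Submission
  imports Defs "HOL-Number_Theory.Residue_Primitive_Roots"
begin

text \<open>
  The equation is homogeneous in a way that no nonzero additive maps can match. Additive maps
  commute with multiplication by integers, hence with multiplication by any element \<open>k\<close> of
  the prime field. Replacing \<open>X\<close> by \<open>k X\<close> multiplies \<open>f X\<close> by \<open>k\<close>, whereas it multiplies
  \<open>X\<^sup>n g(X\<^sup>-\<^sup>1)\<close> by \<open>k\<^sup>n k\<^sup>-\<^sup>1\<close>; so \<open>k f(X) = k\<^sup>n\<^sup>-\<^sup>1 f(X)\<close> for every invertible \<open>X\<close>.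
  Since \<open>0 < n - 2 < p - 1\<close> in characteristic \<open>p > n\<close>, a primitive root \<open>k\<close> modulo \<open>p\<close>
  satisfies \<open>k\<^sup>n\<^sup>-\<^sup>2 \<noteq> 1\<close>; in characteristic \<open>0\<close>, take \<open>k = 2\<close>
  (lemma \<open>exists_of_nat_power_neq_one\<close>). Hence \<open>f\<close> vanishes on all invertible matrices, and then
  so does \<open>g\<close>, because \<open>X\<^sup>n\<close> can be cancelled. Invertible matrices span the whole matrix ring
  additively (lemma \<open>additive_zero_if_zero_on_invertible\<close>), so both maps are zero.
\<close>

section \<open>An element of the prime field with a nontrivial power\<close>

lemma prime_CHAR_division_ring:
  assumes "CHAR('d::division_ring) \<noteq> 0"
  shows "prime CHAR('d)"
proof (rule prime_natI)
  show "2 \<le> CHAR('d)"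
    using assms CHAR_not_1[where 'a='d] by linarith
next
  fix a b :: nat
  assume "CHAR('d) dvd a * b"
  hence "of_nat a * of_nat b = (0 :: 'd)"
    by (metis of_nat_eq_0_iff_char_dvd of_nat_mult)
  thus "CHAR('d) dvd a \<or> CHAR('d) dvd b"
    by (simp add: of_nat_eq_0_iff_char_dvd)
qed

text \<open>
  In characteristic \<open>p\<close> the bound \<open>d < p - 1\<close> is sharp, by Fermat's little theorem. Any primitive
  root works because its order \<open>p - 1\<close> cannot divide \<open>d\<close>.
\<close>

lemma exists_of_nat_power_neq_one:
  fixes d :: nat
  assumes "d > 0" and "CHAR('d::division_ring) > d + 1 \<or> CHAR('d) = 0"
  shows "\<exists>k. of_nat k \<noteq> (0::'d) \<and> of_nat k ^ d \<noteq> (1::'d)"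
proof (cases "CHAR('d) = 0")
  case True
  hence "of_nat 2 \<noteq> (0::'d)"
    unfolding of_nat_eq_0_iff_char_dvd by simp
  moreover have "(2::nat) ^ d \<noteq> 1"
    using \<open>d > 0\<close> by simp
  hence "of_nat (2 ^ d) \<noteq> (of_nat 1 :: 'd)"
    unfolding of_nat_eq_iff_cong_CHAR True by simp
  ultimately show ?thesis
    by (metis of_nat_1 of_nat_power)
next
  case False
  let ?p = "CHAR('d)"
  have p: "prime ?p"
    using prime_CHAR_division_ring[OF False] .
  then obtain k where k: "residue_primroot ?p k"
    using prime_primitive_root_exists[of ?p] prime_gt_1_nat by blast
  hence "ord ?p k = ?p - 1" and "coprime ?p k"
    using p by (auto simp: residue_primroot_def totient_prime)
  moreover have "\<not> ?p - 1 dvd d"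
    using assms False by (auto dest: dvd_imp_le)
  ultimately have "\<not> [k ^ d = 1] (mod ?p)" and "\<not> ?p dvd k"
    using p by (auto simp: ord_divides' coprime_absorb_left)
  hence "of_nat (k ^ d) \<noteq> (of_nat 1 :: 'd)" and "of_nat k \<noteq> (0::'d)"
    unfolding of_nat_eq_iff_cong_CHAR of_nat_eq_0_iff_char_dvd by auto
  thus ?thesis
    by (metis of_nat_1 of_nat_power)
qed

section \<open>Scaling matrices by central elements\<close>

definition mat_scale :: "'a::times \<Rightarrow> 'a ^ 'm ^ 'n \<Rightarrow> 'a ^ 'm ^ 'n" where
  "mat_scale c A = (\<chi> i j. c * A $ i $ j)"

lemma mat_scale_mat_scale:
  fixes A :: "'a::semigroup_mult ^ 'm ^ 'n"
  shows "mat_scale c (mat_scale d A) = mat_scale (c * d) A"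
  by (simp add: mat_scale_def mult.assoc)

lemma mat_scale_one [simp]:
  fixes A :: "'a::monoid_mult ^ 'm ^ 'n"
  shows "mat_scale 1 A = A"
  by (simp add: mat_scale_def vec_eq_iff)

lemma matrix_mul_mat_scale_left:
  fixes A :: "'a::semiring_1 ^ 'm ^ 'n" and B :: "'a ^ 'k ^ 'm"
  shows "mat_scale c A ** B = mat_scale c (A ** B)"
  by (simp add: mat_scale_def matrix_matrix_mult_def vec_eq_iff sum_distrib_left mult.assoc)

lemma matrix_mul_mat_scale_right:
  fixes A :: "'a::semiring_1 ^ 'm ^ 'n" and B :: "'a ^ 'k ^ 'm"
  assumes central: "\<And>x. c * x = x * c"
  shows "A ** mat_scale c B = mat_scale c (A ** B)"
proof -
  have "x * (c * y) = c * (x * y)" for x y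
    by (metis central mult.assoc)
  thus ?thesis
    by (simp add: mat_scale_def matrix_matrix_mult_def vec_eq_iff sum_distrib_left)
qed

lemma matrix_power_mat_scale:
  fixes A :: "'a::semiring_1 ^ 'm ^ 'm"
  assumes central: "\<And>x. c * x = x * c"
  shows "matrix_power (mat_scale c A) n = mat_scale (c ^ n) (matrix_power A n)"
proof (induction n)
  case (Suc n)
  have central_power: "c ^ n * x = x * c ^ n" for x
    by (metis central power_commuting_commutes)
  show ?case
    by (simp only: matrix_power.simps Suc matrix_mul_mat_scale_left
        matrix_mul_mat_scale_right[OF central_power] mat_scale_mat_scale power_Suc power_commutes)
qed simp

lemma mat_scale_zero_left [simp]:
  fixes A :: "'a::mult_zero ^ 'm ^ 'n"
  shows "mat_scale 0 A = 0"
  by (simp add: mat_scale_def vec_eq_iff)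

lemma mat_scale_add_left:
  fixes A :: "'a::semiring ^ 'm ^ 'n"
  shows "mat_scale (c + d) A = mat_scale c A + mat_scale d A"
  by (simp add: mat_scale_def vec_eq_iff distrib_right)

lemma additive_mat_scale_of_nat:
  fixes f :: "'a::ring_1 ^ 'm ^ 'n \<Rightarrow> 'a ^ 'k ^ 'l"
  assumes "Modules.additive f"
  shows "f (mat_scale (of_nat k) X) = mat_scale (of_nat k) (f X)"
  by (induction k)
    (simp_all add: mat_scale_add_left additive.zero[OF assms] additive.add[OF assms])

section \<open>Invertible matrices span the matrix ring additively\<close>

definition matrix_unit :: "'m \<Rightarrow> 'n \<Rightarrow> 'a::zero \<Rightarrow> 'a ^ 'n ^ 'm" where
  "matrix_unit i j a = (\<chi> r s. if r = i \<and> s = j then a else 0)"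

lemma sum_matrix_unit:
  fixes X :: "'a::comm_monoid_add ^ 'n ^ 'm"
  shows "X = (\<Sum>i\<in>UNIV. \<Sum>j\<in>UNIV. matrix_unit i j (X $ i $ j))"
proof -
  have "(\<Sum>i\<in>UNIV. \<Sum>j\<in>UNIV. matrix_unit i j (X $ i $ j)) $ r $ s = X $ r $ s" for r s
  proof -
    have "(if r = i \<and> s = j then X $ i $ j else 0)
        = (if i = r then if j = s then X $ i $ j else 0 else 0)" for i j
      by auto
    thus ?thesis
      by (simp add: matrix_unit_def if_distrib[of "sum _"] sum.If_cases)
  qed
  thus ?thesis
    by (simp add: vec_eq_iff)
qed

lemma matrix_unit_mult:
  fixes a b :: "'a::semiring_1"
  shows "matrix_unit i j a ** matrix_unit k l b = (if j = k then matrix_unit i l (a * b) else 0)"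
proof -
  have "(matrix_unit i j a ** matrix_unit k l b) $ r $ s
      = (\<Sum>t\<in>UNIV. if t = j then if r = i \<and> j = k \<and> s = l then a * b else 0 else 0)" for r s
    unfolding matrix_matrix_mult_def matrix_unit_def vec_lambda_beta by (rule sum.cong) auto
  thus ?thesis
    by (auto simp: vec_eq_iff matrix_unit_def)
qed

text \<open>
  Off the diagonal these are transvections, with inverse \<open>1 - a e\<^sub>i\<^sub>j\<close>. On the diagonal the
  element \<open>1 + a\<close> of the division ring is inverted.
\<close>

lemma invertible_one_plus_matrix_unit:
  fixes a :: "'a::division_ring" and i j :: "'m::finite"
  assumes "i \<noteq> j \<or> 1 + a \<noteq> 0"
  shows "invertible (mat 1 + matrix_unit i j a)"
proof -
  define b where "b = (if i = j then inverse (1 + a) - 1 else - a)"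
  have rdistrib: "(A + B) ** C = A ** C + B ** C" for A B C :: "'a ^ 'm ^ 'm"
    by (simp add: matrix_matrix_mult_def vec_eq_iff distrib_right sum.distrib)
  have unit_add: "matrix_unit i j x + matrix_unit i j y = matrix_unit i j (x + y)" for x y :: 'a
    by (simp add: matrix_unit_def vec_eq_iff)
  have unit_0: "matrix_unit i j (0::'a) = 0"
    by (simp add: matrix_unit_def vec_eq_iff)
  have product: "(mat 1 + matrix_unit i j x) ** (mat 1 + matrix_unit i j y) = mat 1"
    if "x + y + (if i = j then x * y else 0) = 0" for x y :: 'a
  proof -
    have "(mat 1 + matrix_unit i j x) ** (mat 1 + matrix_unit i j y)
        = mat 1 + matrix_unit i j (x + y + (if i = j then x * y else 0))"
      by (simp add: rdistrib matrix_add_ldistrib matrix_unit_mult flip: unit_add)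
        (simp add: unit_0 ac_simps)
    thus ?thesis
      by (simp add: that unit_0)
  qed
  have "a + b + (if i = j then a * b else 0) = 0"
  proof (cases "i = j")
    case True
    hence "(1 + a) * (1 + b) = 1"
      using assms by (simp add: b_def)
    thus ?thesis
      using True by (simp add: algebra_simps)
  qed (simp add: b_def)
  moreover have "b + a + (if i = j then b * a else 0) = 0"
  proof (cases "i = j")
    case True
    hence "(1 + b) * (1 + a) = 1"
      using assms by (simp add: b_def)
    thus ?thesis
      using True by (simp add: algebra_simps)
  qed (simp add: b_def)
  ultimately show ?thesis
    unfolding invertible_def using product by blast
qed

text \<open>
  A matrix unit \<open>a e\<^sub>i\<^sub>j\<close> is the difference of the invertible matrices \<open>1 + a e\<^sub>i\<^sub>j\<close> and \<open>1\<close>,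
  except that \<open>1 - e\<^sub>i\<^sub>i\<close> is singular. The negative of \<open>-e\<^sub>i\<^sub>i\<close> is not exceptional, provided
  that \<open>1 + 1 \<noteq> 0\<close>.
\<close>

lemma additive_zero_if_zero_on_invertible:
  fixes f :: "'a::division_ring ^ 'm ^ 'm \<Rightarrow> 'b::ab_group_add"
  assumes f: "Modules.additive f" and vanish: "\<And>X. invertible X \<Longrightarrow> f X = 0"
    and two: "(2::'a) \<noteq> 0"
  shows "f X = 0"
proof -
  interpret additive f
    by (rule f)
  have "invertible (mat 1 :: 'a ^ 'm ^ 'm)"
    unfolding invertible_def by (intro exI[of _ "mat 1"]) simp
  hence f_one: "f (mat 1) = 0"
    by (rule vanish)
  have regular: "f (matrix_unit i j a) = 0" if "i \<noteq> j \<or> 1 + a \<noteq> 0" for i j a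
    using vanish[OF invertible_one_plus_matrix_unit[OF that]] by (simp add: add f_one)
  have f_matrix_unit: "f (matrix_unit i j a) = 0" for i j a
  proof (cases "1 + a = 0")
    case True
    hence "a = - 1"
      by (simp add: add_eq_0_iff)
    hence "matrix_unit i j a = - matrix_unit i j (1::'a)"
      by (simp add: matrix_unit_def vec_eq_iff)
    moreover have "f (matrix_unit i j 1) = 0"
      using two by (intro regular) simp
    ultimately show ?thesis
      by (simp add: minus)
  qed (use regular in blast)
  have "f X = f (\<Sum>i\<in>UNIV. \<Sum>j\<in>UNIV. matrix_unit i j (X $ i $ j))"
    by (simp flip: sum_matrix_unit)
  also have "\<dots> = 0"
    by (simp add: sum f_matrix_unit)
  finally show ?thesis .
qed

section \<open>The functional equation\<close>

lemma matrix_inv_eqI: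
  fixes X Y :: "'a::semiring_1 ^ 'm ^ 'm"
  assumes "X ** Y = mat 1" and "Y ** X = mat 1"
  shows "matrix_inv X = Y"
proof -
  have "X ** matrix_inv X = mat 1 \<and> matrix_inv X ** X = mat 1"
    unfolding matrix_inv_def by (rule someI[of _ Y]) (use assms in simp)
  thus ?thesis
    by (metis assms(2) matrix_mul_assoc matrix_mul_lid matrix_mul_rid)
qed

text \<open>
  Let \<open>c\<close> be the image of \<open>k\<close> in the prime field. It is central, so it moves out of
  matrix products and \<open>(c X)\<^sup>-\<^sup>1 = c\<^sup>-\<^sup>1 X\<^sup>-\<^sup>1\<close>. Additivity of \<open>g\<close> is used for the
  multiplier \<open>c\<close> rather than \<open>c\<^sup>-\<^sup>1\<close>, in the form \<open>c g(c\<^sup>-\<^sup>1 Y) = g(Y)\<close>; this absorbs one of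
  the factors \<open>c\<close> from \<open>(c X)\<^sup>n\<^sup>+\<^sup>1\<close>.
\<close>

lemma scaled_functional_equation:
  fixes f g :: "'d::division_ring ^ 'm ^ 'm \<Rightarrow> 'd ^ 'm ^ 'm"
  assumes f: "Modules.additive f" and g: "Modules.additive g"
    and eq: "\<And>X. invertible X \<Longrightarrow> f X + matrix_power X (Suc n) ** g (matrix_inv X) = 0"
    and X: "invertible X" and nz: "of_nat k \<noteq> (0::'d)"
  shows "mat_scale (of_nat k) (f X) = mat_scale (of_nat k ^ n) (f X)"
proof -
  define c :: 'd where "c = of_nat k"
  have central: "c * x = x * c" for x
    by (simp add: c_def mult_of_nat_commute)
  have central_inverse: "inverse c * x = x * inverse c" for x
  proof -
    have "inverse c * x = inverse c * (x * c) * inverse c"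
      using nz by (simp add: c_def mult.assoc)
    also have "\<dots> = x * inverse c"
      using nz by (simp add: c_def mult.assoc[symmetric] flip: central[unfolded c_def])
    finally show ?thesis .
  qed
  obtain Y where Y: "X ** Y = mat 1" "Y ** X = mat 1"
    using X unfolding invertible_def by blast
  let ?Z = "mat_scale (inverse c) Y"
  have Z: "mat_scale c X ** ?Z = mat 1" "?Z ** mat_scale c X = mat 1"
    using nz Y by (simp_all add: c_def[symmetric] matrix_mul_mat_scale_left
        matrix_mul_mat_scale_right[OF central] matrix_mul_mat_scale_right[OF central_inverse]
        mat_scale_mat_scale)
  have "invertible (mat_scale c X)"
    unfolding invertible_def using Z by blast
  from eq[OF this] have "mat_scale c (f X)
      + matrix_power (mat_scale c X) (Suc n) ** g ?Z = 0"
    by (simp only: matrix_inv_eqI[OF Z]) (simp only: c_def additive_mat_scale_of_nat[OF f])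
  also have "matrix_power (mat_scale c X) (Suc n) ** g ?Z
      = mat_scale (c ^ n) (matrix_power X (Suc n) ** mat_scale c (g ?Z))"
    by (simp only: matrix_power_mat_scale[OF central] matrix_mul_mat_scale_left
        matrix_mul_mat_scale_right[OF central] mat_scale_mat_scale power_Suc2)
  also have "mat_scale c (g ?Z) = g (mat_scale c ?Z)"
    by (simp only: c_def additive_mat_scale_of_nat[OF g])
  also have "mat_scale c ?Z = Y"
    using nz by (simp add: c_def mat_scale_mat_scale)
  also have "matrix_power X (Suc n) ** g Y = - f X"
    using eq[OF X] by (simp only: matrix_inv_eqI[OF Y] add_eq_0_iff)
  also have "mat_scale (c ^ n) (- f X) = - mat_scale (c ^ n) (f X)"
    by (simp add: mat_scale_def vec_eq_iff)
  finally show ?thesis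
    by (simp add: c_def)
qed

theorem theorem1p6:
  fixes n :: nat
    and f g :: "'d::division_ring ^ 'm ^ 'm \<Rightarrow> 'd ^ 'm ^ 'm"
  assumes "n \<ge> 3"
    and "CHAR('d) > n \<or> CHAR('d) = 0"
    and "CARD('m) > 1"
    and "Modules.additive f"
    and "Modules.additive g"
    and "\<And>X. invertible X \<Longrightarrow> f X + matrix_power X n ** g (matrix_inv X) = 0"
  shows "f = (\<lambda>X. 0) \<and> g = (\<lambda>X. 0)"
proof -
  obtain d where n: "n = Suc (Suc d)" and "d > 0"
    using \<open>n \<ge> 3\<close> by (intro that[of "n - 2"]) auto
  have "CHAR('d) > d + 1 \<or> CHAR('d) = 0"
    using assms(2) n by linarith
  then obtain k where k: "of_nat k \<noteq> (0::'d)" "of_nat k ^ d \<noteq> (1::'d)"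
    using exists_of_nat_power_neq_one[OF \<open>d > 0\<close>] by blast
  have two: "(2::'d) \<noteq> 0"
  proof -
    have "\<not> CHAR('d) dvd 2"
      using assms(1,2) by (auto dest: dvd_imp_le)
    thus ?thesis
      using of_nat_eq_0_iff_char_dvd[where 'a='d, of 2] by simp
  qed
  have f_unit: "f X = 0" if X: "invertible X" for X
  proof -
    have "mat_scale (of_nat k) (f X) = mat_scale (of_nat k ^ Suc d) (f X)"
      using assms(6) by (intro scaled_functional_equation[OF assms(4,5) _ X k(1)]) (simp add: n)
    thus ?thesis
      using k by (auto simp: mat_scale_def vec_eq_iff mult.assoc)
  qed
  have g_unit: "g Y = 0" if Y: "invertible Y" for Y
  proof -
    obtain X where X: "X ** Y = mat 1" "Y ** X = mat 1"
      using Y unfolding invertible_def by blast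
    hence "invertible X"
      unfolding invertible_def by blast
    hence "matrix_power X n ** g Y = 0"
      using assms(6)[of X] by (simp add: f_unit matrix_inv_eqI[OF X])
    \<comment> \<open>The factors \<open>X\<close> of the power are cancelled one at a time.\<close>
    hence "g Y = 0"
    proof (induction n)
      case (Suc l)
      have "matrix_power X l ** g Y = Y ** (matrix_power X (Suc l) ** g Y)"
        by (simp add: matrix_mul_assoc X)
      thus ?case
        using Suc by simp
    qed simp
    thus ?thesis .
  qed
  show ?thesis
    using additive_zero_if_zero_on_invertible[OF assms(4) f_unit two]
      additive_zero_if_zero_on_invertible[OF assms(5) g_unit two] by blast
qed

end
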